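(* Let $T>0$ and $\sigma\ge0$. For a deterministic control $g\in L^6([0,T])$ let $u^g$ be the solution of $$\mathrm{d}u^g_t=[-V'(u^g_t)+g(t)]\,\mathrm{d}t+\sigma\,\mathrm{d}B_t,\quad t\in[0,T],\qquad u^g_0=0,$$ where $(B_t)_{t\ge0}$ is a real Brownian motion and $V:\mathbb{R}\to\mathbb{R}$ is given by $V(x)=\frac12(\arctan(x)-x)$ for $x\ge0$ and $V(x)=0$ for $x<0$. Let $$J(g)=\mathbb{E}\left[\tfrac12(u^g_T)^2\right].$$ (i) If $\sigma=0$, then $g\equiv0$ is an optimal control, i.e. it minimizes $J$. (ii) If $\sigma>0$, then the gradient $\nabla J(0)$ of $J$ at $g\equiv0$ is not equal to zero, and $g\equiv0$ is not an optimal control, i.e. it does not minimize $J$.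
   Context: The gradient $\nabla J(g)$ is the function on $[0,T]$ such that the Gâteaux derivative $\lim_{\delta\to0}\frac1\delta(J(g+\delta h)-J(g))$ equals $\int_0^T\nabla J(g)(t)h(t)\,\mathrm{d}t$ for all directions $h\in L^6([0,T])$. *)

theory Defs
  imports "HOL-Probability.Probability"
begin

text \<open>Standard real Brownian motion, with respect to its own filtration; only times
  \<open>t \<ge> 0\<close> matter.\<close>

definition brownian_motion :: "'a measure \<Rightarrow> (real \<Rightarrow> 'a \<Rightarrow> real) \<Rightarrow> bool" where
  "brownian_motion M B \<longleftrightarrow>
     (\<forall>t\<ge>0. B t \<in> borel_measurable M) \<and>
     (AE \<omega> in M. B 0 \<omega> = 0) \<and>
     (\<forall>(n::nat) \<tau> :: nat \<Rightarrow> real. 0 \<le> \<tau> 0 \<longrightarrow> mono_on {..n} \<tau> \<longrightarrow>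
        prob_space.indep_vars M (\<lambda>_. borel)
          (\<lambda>i \<omega>. B (\<tau> (Suc i)) \<omega> - B (\<tau> i) \<omega>) {..<n}) \<and>
     (\<forall>s t. 0 \<le> s \<longrightarrow> s < t \<longrightarrow>
        distributed M lborel (\<lambda>\<omega>. B t \<omega> - B s \<omega>)
          (\<lambda>x. ennreal (normal_density 0 (sqrt (t - s)) x))) \<and>
     (AE \<omega> in M. continuous_on {0..} (\<lambda>t. B t \<omega>))"

definition V :: "real \<Rightarrow> real" where
  "V x = (if x \<ge> 0 then 1/2 * (arctan x - x) else 0)"

text \<open>Representatives of elements of \<open>L\<^sup>6([0,T])\<close>; values outside \<open>[0,T]\<close> are
  irrelevant.\<close>

definition L6 :: "real \<Rightarrow> (real \<Rightarrow> real) set" where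
  "L6 T = {g. set_borel_measurable lebesgue {0..T} g \<and>
              set_integrable lebesgue {0..T} (\<lambda>t. \<bar>g t\<bar> ^ 6)}"

text \<open>Solutions on \<open>[0,T]\<close> of \<open>du = (-V'(u) + g(t)) dt + \<sigma> dB\<close>, \<open>u(0) = 0\<close>. Since the
  noise is additive, the stochastic integral of the constant \<open>\<sigma>\<close> is \<open>\<sigma> B\<close> and the SDE is the
  integral equation below, holding almost surely for all times simultaneously. The drift is
  Lipschitz in \<open>u\<close>, so this determines \<open>u\<close> up to indistinguishability; in particular,
  adaptedness up to null sets need not be required separately.\<close>

definition sde_solution ::
  "'a measure \<Rightarrow> (real \<Rightarrow> 'a \<Rightarrow> real) \<Rightarrow> real \<Rightarrow> real \<Rightarrow> (real \<Rightarrow> real) \<Rightarrow>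
   (real \<Rightarrow> 'a \<Rightarrow> real) \<Rightarrow> bool" where
  "sde_solution M B \<sigma> T g u \<longleftrightarrow>
     (\<forall>t\<in>{0..T}. u t \<in> borel_measurable M) \<and>
     (AE \<omega> in M. continuous_on {0..T} (\<lambda>t. u t \<omega>) \<and>
        (\<forall>t\<in>{0..T}. u t \<omega> =
           (LINT s:{0..t}|lebesgue. - deriv V (u s \<omega>) + g s) + \<sigma> * B t \<omega>))"

text \<open>The objective, for a family \<open>u\<close> assigning to each control its state process.\<close>

definition cost :: "'a measure \<Rightarrow> real \<Rightarrow> ((real \<Rightarrow> real) \<Rightarrow> real \<Rightarrow> 'a \<Rightarrow> real) \<Rightarrow>
    (real \<Rightarrow> real) \<Rightarrow> real" where
  "cost M T u g = prob_space.expectation M (\<lambda>\<omega>. 1/2 * (u g T \<omega>)\<^sup>2)"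

definition is_optimal_control ::
  "real \<Rightarrow> ((real \<Rightarrow> real) \<Rightarrow> real) \<Rightarrow> (real \<Rightarrow> real) \<Rightarrow> bool" where
  "is_optimal_control T J g \<longleftrightarrow> g \<in> L6 T \<and> (\<forall>g'\<in>L6 T. J g \<le> J g')"

text \<open>\<open>G\<close> represents the gradient of \<open>J\<close> at \<open>g\<close>. Such a \<open>G\<close> is unique only up to
  equality almost everywhere on \<open>[0,T]\<close>.\<close>

definition is_gradient ::
  "real \<Rightarrow> ((real \<Rightarrow> real) \<Rightarrow> real) \<Rightarrow> (real \<Rightarrow> real) \<Rightarrow> (real \<Rightarrow> real) \<Rightarrow> bool" where
  "is_gradient T J g G \<longleftrightarrow>
     (\<forall>h\<in>L6 T. set_integrable lebesgue {0..T} (\<lambda>t. G t * h t) \<and>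
        ((\<lambda>\<delta>. 1/\<delta> * (J (\<lambda>t. g t + \<delta> * h t) - J g))
           \<longlongrightarrow> (LINT t:{0..T}|lebesgue. G t * h t)) (at 0))"

end

theory Submission
  imports Defs
begin

text \<open>
  Write \<open>drift\<close> for \<open>- V'\<close>. It is a bounded nonnegative function that vanishes exactly on the
  nonpositive half-line, and it is continuously differentiable with a Lipschitz derivative.
  Without noise, the state under the zero control rests at \<open>0\<close>, so the cost is zero, which is
  minimal. With noise, the state is pushed into the positive half-line with positive probability,
  and there the drift carries it further up, so the terminal state \<open>X\<^sub>T\<close> has positive mean
  (\<open>uncontrolled_state_moments\<close>); steering slightly downwards just before time \<open>T\<close> then lowers
  the second moment.

  To make this precise, the gradient at the zero control is identified as
  \<open>G s = E [X\<^sub>T * exp (\<integral>\<^sub>s\<^sup>T drift' (X\<^sub>r) dr)]\<close>. The noise being additive, two solutions driven by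
  different controls differ by the solution of a random ordinary differential equation, and one can
  argue path by path: the effect of the control \<open>\<delta> * h\<close> on the terminal state is \<open>\<delta>\<close> times the
  integral of \<open>h\<close> against the exponential above, up to an error of order \<open>\<delta>\<^sup>2\<close> that is uniform in
  the path (\<open>path_perturbation\<close>). Expanding the square and applying Fubini's theorem yields
  \<open>gradient_at_zero\<close>.

  The exponential is close to \<open>1\<close> when \<open>s\<close> is close to \<open>T\<close>, so \<open>G\<close> is bounded below there by a
  positive constant (\<open>gradient_pos_near_terminal_time\<close>). Testing with the indicator \<open>h\<close> of a short
  interval ending at \<open>T\<close> gives a strictly positive directional derivative. This derivative is a
  limit, hence the same for every representative of the gradient: none of them can vanish almost
  everywhere. For small negative \<open>\<delta>\<close> the control \<open>\<delta> * h\<close> is cheaper than the zero control.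
\<close>

section \<open>The drift\<close>

definition drift :: "real \<Rightarrow> real" where
  "drift x = (if 0 \<le> x then x\<^sup>2 / (2 * (1 + x\<^sup>2)) else 0)"

definition drift' :: "real \<Rightarrow> real" where
  "drift' x = (if 0 \<le> x then x / (1 + x\<^sup>2)\<^sup>2 else 0)"

text \<open>The potential and the drift are both of this form. A zero of order at least two of the
positive branch makes the glued function differentiable across the origin, because its difference
quotient there is dominated by that of the positive branch.\<close>

lemma has_real_derivative_glue_zero:
  fixes F F' :: "real \<Rightarrow> real"
  assumes F: "\<And>x. (F has_real_derivative F' x) (at x)"
    and F0: "F 0 = 0" "F' 0 = 0"
  shows "((\<lambda>x. if 0 \<le> x then F x else 0) has_real_derivative (if 0 \<le> x then F' x else 0)) (at x)"
proof -
  consider "x > 0" | "x = 0" | "x < 0" by linarith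
  then show ?thesis
  proof cases
    case 1
    have "((\<lambda>x. if 0 \<le> x then F x else 0) has_real_derivative F' x) (at x)"
      by (rule DERIV_cong_ev[THEN iffD1, OF refl _ refl F])
        (use 1 eventually_nhds_in_open[of "{0<..}" x] in \<open>auto elim!: eventually_mono\<close>)
    then show ?thesis using 1 by simp
  next
    case 3
    have "((\<lambda>x. if 0 \<le> x then F x else 0) has_real_derivative 0) (at x)"
      by (rule DERIV_cong_ev[THEN iffD1, OF refl _ refl DERIV_const[of 0]])
        (use 3 eventually_nhds_in_open[of "{..<0}" x] in \<open>auto elim!: eventually_mono\<close>)
    then show ?thesis using 3 by simp
  next
    case 2
    have "((\<lambda>y. F y / y) \<longlongrightarrow> 0) (at 0)"
      using F[of 0] F0 by (simp add: has_field_derivative_iff)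
    moreover have "norm ((if 0 \<le> y then F y else 0) / y) \<le> norm (F y / y)" for y
      by (cases "0 \<le> y") (simp_all only: if_True if_False div_0 norm_zero norm_ge_zero order_refl)
    ultimately have "((\<lambda>y. (if 0 \<le> y then F y else 0) / y) \<longlongrightarrow> 0) (at 0)"
      using Lim_null_comparison[OF always_eventually tendsto_norm_zero] by fast
    then show ?thesis using 2 F0 by (simp add: has_field_derivative_iff)
  qed
qed

lemma one_plus_sq_pos: "0 < 1 + (x::real)\<^sup>2" by (simp add: add_pos_nonneg)

lemma deriv_V: "deriv V x = - drift x"
proof -
  have "((\<lambda>x. 1/2 * (arctan x - x)) has_real_derivative - (x\<^sup>2 / (2 * (1 + x\<^sup>2)))) (at x)" for x :: real
    using one_plus_sq_pos[of x] by (auto intro!: derivative_eq_intros simp: field_simps)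
  from has_real_derivative_glue_zero[OF this]
  have "((\<lambda>x. if 0 \<le> x then 1/2 * (arctan x - x) else 0) has_real_derivative - drift x) (at x)"
    by (auto simp: drift_def if_distrib cong: if_cong)
  moreover have "(\<lambda>x. if 0 \<le> x then 1/2 * (arctan x - x) else 0) = V" by (auto simp: V_def)
  ultimately show ?thesis by (auto intro: DERIV_imp_deriv)
qed

lemma drift_has_real_derivative: "(drift has_real_derivative drift' x) (at x)"
proof -
  have "((\<lambda>x. x\<^sup>2 / (2 * (1 + x\<^sup>2))) has_real_derivative (x / (1 + x\<^sup>2)\<^sup>2)) (at x)" for x :: real
  proof -
    define q where "q = 1 + x\<^sup>2"
    have q: "q \<noteq> 0" "x\<^sup>2 = q - 1" using one_plus_sq_pos[of x] by (auto simp: q_def)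
    have "((\<lambda>x. x\<^sup>2 / (2 * (1 + x\<^sup>2))) has_real_derivative
        ((2 * x * (2 * q) - x\<^sup>2 * (2 * (2 * x))) / ((2 * q) * (2 * q)))) (at x)"
      using q(1) unfolding q_def by (auto intro!: derivative_eq_intros)
    also have "(2 * x * (2 * q) - x\<^sup>2 * (2 * (2 * x))) / ((2 * q) * (2 * q)) = x / q\<^sup>2"
      unfolding q(2) using q(1) by (simp add: field_simps power2_eq_square)
    finally show ?thesis by (simp add: q_def)
  qed
  from has_real_derivative_glue_zero[OF this]
  show ?thesis unfolding drift_def drift'_def by simp
qed

lemma drift_nonneg: "0 \<le> drift x" by (simp add: drift_def)

lemma drift_le_one: "drift x \<le> 1"
  using one_plus_sq_pos[of x] by (auto simp: drift_def divide_simps)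

lemma drift_pos: "0 < x \<Longrightarrow> 0 < drift x"
  by (simp add: drift_def add_pos_pos)

lemma drift'_nonneg: "0 \<le> drift' x" by (simp add: drift'_def)

lemma drift'_le_one: "drift' x \<le> 1"
proof -
  have "x \<le> 1 + x\<^sup>2" using sum_squares_bound[of x 1] one_plus_sq_pos[of x]
    by simp
  also have "\<dots> \<le> (1 + x\<^sup>2)\<^sup>2" by (rule self_le_power) auto
  finally show ?thesis using one_plus_sq_pos[of x] by (simp add: drift'_def)
qed

text \<open>The second derivative of the drift jumps at the origin, so the remainder of the
first-order Taylor expansion is controlled through a Lipschitz bound on the derivative
instead.\<close>

lemma drift'_lipschitz: "\<bar>drift' x - drift' y\<bar> \<le> \<bar>x - y\<bar>"
proof -
  let ?c = "\<lambda>x::real. x / (1 + x\<^sup>2)\<^sup>2"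
  have d: "(?c has_real_derivative (1 - 3 * x\<^sup>2) / (1 + x\<^sup>2) ^ 3) (at x)" for x :: real
  proof -
    define q where "q = 1 + x\<^sup>2"
    have q: "q \<noteq> 0" "x\<^sup>2 = q - 1" using one_plus_sq_pos[of x] by (auto simp: q_def)
    have "(?c has_real_derivative ((1 * q\<^sup>2 - x * (2 * q * (2 * x))) / (q\<^sup>2 * q\<^sup>2))) (at x)"
      using q(1) unfolding q_def by (auto intro!: derivative_eq_intros)
    also have "x * (2 * q * (2 * x)) = 4 * q * (q - 1)"
      unfolding q(2)[symmetric] by (simp add: power2_eq_square)
    also have "(1 * q\<^sup>2 - 4 * q * (q - 1)) / (q\<^sup>2 * q\<^sup>2) = (1 - 3 * (q - 1)) / q ^ 3"
      using q(1) by (simp add: field_simps eval_nat_numeral)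
    finally show ?thesis unfolding q(2)[symmetric] by (simp add: q_def)
  qed
  have b: "\<bar>(1 - 3 * x\<^sup>2) / (1 + x\<^sup>2) ^ 3\<bar> \<le> 1" for x :: real
  proof -
    have "\<bar>1 - 3 * x\<^sup>2\<bar> \<le> 1 + 3 * x\<^sup>2" by (simp add: abs_if)
    also have "\<dots> \<le> (1 + x\<^sup>2) ^ 3" by (simp add: power3_eq_cube algebra_simps)
    finally show ?thesis using one_plus_sq_pos[of x] by simp
  qed
  have "norm (?c u - ?c v) \<le> 1 * norm (u - v)" for u v
    by (rule field_differentiable_bound[where S=UNIV and f' = "\<lambda>x. (1 - 3 * x\<^sup>2) / (1 + x\<^sup>2) ^ 3"])
      (use d b in auto)
  then have "\<bar>?c (max 0 x) - ?c (max 0 y)\<bar> \<le> \<bar>max 0 x - max 0 y\<bar>" by simp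
  moreover have "drift' x = ?c (max 0 x)" for x by (simp add: drift'_def max_def)
  moreover have "\<bar>max 0 x - max 0 y\<bar> \<le> \<bar>x - y\<bar>" by (simp add: max_def)
  ultimately show ?thesis by simp
qed

lemma drift_lipschitz: "\<bar>drift x - drift y\<bar> \<le> \<bar>x - y\<bar>"
  using field_differentiable_bound[where S=UNIV and f=drift and f'=drift' and B=1 and x=x and y=y]
    drift_has_real_derivative drift'_nonneg drift'_le_one by auto

lemma drift_taylor: "\<bar>drift y - drift x - drift' x * (y - x)\<bar> \<le> (y - x)\<^sup>2"
proof (cases x y rule: linorder_cases)
  case less
  from MVT2[OF this drift_has_real_derivative]
  obtain z where z: "x < z" "z < y" "drift y - drift x = (y - x) * drift' z" by blast
  have "\<bar>drift y - drift x - drift' x * (y - x)\<bar> = \<bar>drift' z - drift' x\<bar> * \<bar>y - x\<bar>"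
    unfolding z(3) abs_mult[symmetric] by (simp add: algebra_simps)
  also have "\<dots> \<le> \<bar>y - x\<bar> * \<bar>y - x\<bar>"
    using drift'_lipschitz[of z x] z by (intro mult_right_mono) auto
  finally show ?thesis by (simp add: power2_eq_square)
next
  case greater
  from MVT2[OF this drift_has_real_derivative]
  obtain z where z: "y < z" "z < x" "drift x - drift y = (x - y) * drift' z" by blast
  have "drift y - drift x - drift' x * (y - x) = (drift' z - drift' x) * (y - x)"
    using z(3) by (simp add: algebra_simps)
  then have "\<bar>drift y - drift x - drift' x * (y - x)\<bar> = \<bar>drift' z - drift' x\<bar> * \<bar>y - x\<bar>"
    by (simp add: abs_mult)
  also have "\<dots> \<le> \<bar>y - x\<bar> * \<bar>y - x\<bar>"
    using drift'_lipschitz[of z x] z by (intro mult_right_mono) auto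
  finally show ?thesis by (simp add: power2_eq_square)
qed simp

lemma continuous_on_drift: "continuous_on S drift"
  by (rule DERIV_continuous_on[OF has_field_derivative_at_within[OF drift_has_real_derivative]])

lemma continuous_on_drift': "continuous_on S drift'"
  by (auto intro!: lipschitz_on_continuous_on[of 1] lipschitz_onI simp: dist_real_def drift'_lipschitz)

section \<open>Perturbation of a path\<close>

text \<open>The right-hand side of the hypothesis, multiplied by \<open>exp (- t)\<close>, is
nonincreasing. The factor \<open>1\<close> in front of the integral is enough here because the
drift has Lipschitz constant at most \<open>1\<close>.\<close>

lemma gronwall:
  fixes f :: "real \<Rightarrow> real"
  assumes f: "continuous_on {0..T} f"
    and le: "\<And>t. t \<in> {0..T} \<Longrightarrow> f t \<le> A + integral {0..t} f"
    and t: "t \<in> {0..T}"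
  shows "f t \<le> A * exp t"
proof -
  let ?\<psi> = "\<lambda>s. - (A + integral {0..s} f) * exp (- s)"
  let ?\<psi>' = "\<lambda>s. (A + integral {0..s} f - f s) * exp (- s)"
  have "(?\<psi> has_real_derivative ?\<psi>' s) (at s within {0..t})" if "s \<in> {0..t}" for s
  proof -
    have "((\<lambda>s. integral {0..s} f) has_real_derivative f s) (at s within {0..t})"
      using that t by (intro integral_has_real_derivative continuous_on_subset[OF f]) auto
    then show ?thesis by (auto intro!: derivative_eq_intros simp: algebra_simps)
  qed
  then have "(?\<psi>' has_integral (?\<psi> t - ?\<psi> 0)) {0..t}"
    using t by (intro fundamental_theorem_of_calculus)
      (auto simp: has_real_derivative_iff_has_vector_derivative)
  moreover have "0 \<le> ?\<psi>' s" if "s \<in> {0..t}" for s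
    using le[of s] that t by simp
  ultimately have "0 \<le> ?\<psi> t - ?\<psi> 0" by (rule has_integral_nonneg)
  then have "(A + integral {0..t} f) * exp (- t) \<le> A" by (simp add: algebra_simps)
  then have "A + integral {0..t} f \<le> A * exp t" by (simp add: exp_minus field_simps)
  with le[OF t] show ?thesis by simp
qed

text \<open>Variation of constants, by the integrating factor \<open>exp (integral {s..T}
a)\<close>, which is \<open>1\<close> at the terminal time.\<close>

lemma linear_ode_terminal:
  fixes p a q :: "real \<Rightarrow> real"
  assumes T: "0 \<le> T"
    and cont: "continuous_on {0..T} p" "continuous_on {0..T} a" "continuous_on {0..T} q"
    and p: "\<And>t. t \<in> {0..T} \<Longrightarrow> p t = integral {0..t} (\<lambda>s. a s * p s + q s)"
  shows "p T = integral {0..T} (\<lambda>s. exp (integral {s..T} a) * q s)"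
proof -
  let ?E = "\<lambda>s. exp (integral {s..T} a)"
  have "((\<lambda>s. ?E s * p s) has_real_derivative ?E s * q s) (at s within {0..T})" if s: "s \<in> {0..T}" for s
  proof -
    have "((\<lambda>s. integral {0..s} (\<lambda>s. a s * p s + q s)) has_real_derivative a s * p s + q s)
        (at s within {0..T})"
      using s by (intro integral_has_real_derivative continuous_intros cont)
    then have "(p has_real_derivative a s * p s + q s) (at s within {0..T})"
      by (rule has_field_derivative_transform_within[of _ _ _ _ 1]) (use s p in auto)
    moreover have "((\<lambda>s. integral {s..T} a) has_real_derivative - a s) (at s within {0..T})"
      using s by (intro integral_has_real_derivative' cont)
    ultimately show ?thesis by (auto intro!: derivative_eq_intros simp: algebra_simps)
  qed
  then have "((\<lambda>s. ?E s * q s) has_integral (?E T * p T - ?E 0 * p 0)) {0..T}"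
    using T by (intro fundamental_theorem_of_calculus)
      (auto simp: has_real_derivative_iff_has_vector_derivative)
  moreover have "p 0 = 0" using p[of 0] T by simp
  ultimately show ?thesis by (simp add: integral_unique)
qed

text \<open>This is used twice: pathwise, with an indicator of a triangle as the kernel, and for
the exchange of expectation and time integral, with the sensitivity as the kernel.\<close>

lemma Fubini_bounded_kernel:
  fixes X :: "'a \<Rightarrow> real" and f :: "'b \<Rightarrow> real" and K :: "'a \<Rightarrow> 'b \<Rightarrow> real"
  assumes "sigma_finite_measure M" "sigma_finite_measure N"
    and X: "integrable M X" and f: "integrable N f"
    and K: "(\<lambda>(x, y). K x y) \<in> borel_measurable (M \<Otimes>\<^sub>M N)"
    and C: "\<And>x y. x \<in> space M \<Longrightarrow> y \<in> space N \<Longrightarrow> \<bar>K x y\<bar> \<le> C"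
  shows "integrable N (\<lambda>y. (\<integral>x. X x * K x y \<partial>M) * f y)"
    and "integrable M (\<lambda>x. X x * (\<integral>y. K x y * f y \<partial>N))"
    and "(\<integral>x. X x * (\<integral>y. K x y * f y \<partial>N) \<partial>M) = (\<integral>y. (\<integral>x. X x * K x y \<partial>M) * f y \<partial>N)"
proof -
  interpret M: sigma_finite_measure M by fact
  interpret N: sigma_finite_measure N by fact
  interpret pair_sigma_finite M N ..
  note [measurable] = borel_measurable_integrable[OF X] borel_measurable_integrable[OF f] K
  have prod: "integrable (M \<Otimes>\<^sub>M N) (\<lambda>(x, y). X x * f y)"
    by (rule Fubini_integrable) (use X f in \<open>auto simp: abs_mult\<close>)
  have int: "integrable (M \<Otimes>\<^sub>M N) (\<lambda>(x, y). X x * K x y * f y)"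
  proof (rule Bochner_Integration.integrable_bound)
    show "integrable (M \<Otimes>\<^sub>M N) (\<lambda>z. C * (case z of (x, y) \<Rightarrow> X x * f y))"
      using prod by simp
    show "AE z in M \<Otimes>\<^sub>M N. norm (case z of (x, y) \<Rightarrow> X x * K x y * f y)
        \<le> norm (C * (case z of (x, y) \<Rightarrow> X x * f y))"
    proof (rule AE_I2)
      fix z assume "z \<in> space (M \<Otimes>\<^sub>M N)"
      then obtain x y where z: "z = (x, y)" "x \<in> space M" "y \<in> space N"
        by (auto simp: space_pair_measure)
      have "\<bar>K x y\<bar> * \<bar>X x * f y\<bar> \<le> \<bar>C\<bar> * \<bar>X x * f y\<bar>"
        using C[OF z(2,3)] by (intro mult_right_mono) auto
      then show "norm (case z of (x, y) \<Rightarrow> X x * K x y * f y)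
        \<le> norm (C * (case z of (x, y) \<Rightarrow> X x * f y))"
        by (simp add: z abs_mult mult_ac)
    qed
  qed measurable
  show "integrable N (\<lambda>y. (\<integral>x. X x * K x y \<partial>M) * f y)"
    using integrable_snd[OF int] by simp
  show "integrable M (\<lambda>x. X x * (\<integral>y. K x y * f y \<partial>N))"
    using integrable_fst[OF int] by (simp add: mult.assoc)
  show "(\<integral>x. X x * (\<integral>y. K x y * f y \<partial>N) \<partial>M) = (\<integral>y. (\<integral>x. X x * K x y \<partial>M) * f y \<partial>N)"
  proof -
    have "(\<integral>x. X x * (\<integral>y. K x y * f y \<partial>N) \<partial>M) = (\<integral>x. \<integral>y. X x * K x y * f y \<partial>N \<partial>M)"
      by (simp add: mult.assoc)
    also have "\<dots> = (\<integral>y. \<integral>x. X x * K x y * f y \<partial>M \<partial>N)"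
      using Fubini_integral[OF int] by simp
    finally show ?thesis by simp
  qed
qed

lemma absolutely_integrable_continuous_mult:
  fixes u v :: "real \<Rightarrow> real"
  assumes u: "continuous_on {a..b} u" and v: "v absolutely_integrable_on {a..b}"
  shows "(\<lambda>s. u s * v s) absolutely_integrable_on {a..b}"
  using absolutely_integrable_bounded_measurable_product_real[OF
      continuous_imp_measurable_on_sets_lebesgue[OF u] _
      compact_imp_bounded[OF compact_continuous_image[OF u compact_Icc]] v] by simp

lemma integral_swap_triangle:
  fixes f g :: "real \<Rightarrow> real"
  assumes f: "f absolutely_integrable_on {0..T}" and g: "g absolutely_integrable_on {0..T}"
  shows "integral {0..T} (\<lambda>s. f s * integral {s..T} g) = integral {0..T} (\<lambda>r. integral {0..r} f * g r)"
proof -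
  let ?N = "lebesgue_on {0..T}"
  have sf: "sigma_finite_measure ?N"
    using finite_measure_lebesgue_on[of "{0..T}"] by (auto intro: finite_measure.axioms)
  have fN: "integrable ?N f" and gN: "integrable ?N g"
    using f g by (auto simp: absolutely_integrable_imp_integrable)
  have fm[measurable]: "f \<in> borel_measurable ?N" "g \<in> borel_measurable ?N" using fN gN by auto
  have [measurable]: "(\<lambda>x. x) \<in> borel_measurable ?N" by (auto intro!: measurable_restrict_space1 measurable_completion)
  have K: "(\<lambda>(s, r). indicator {s..} r :: real) \<in> borel_measurable (?N \<Otimes>\<^sub>M ?N)"
  proof -
    have "(\<lambda>z. if fst z \<le> snd z then 1 else 0 :: real) \<in> borel_measurable (?N \<Otimes>\<^sub>M ?N)" by measurable
    also have "(\<lambda>z. if fst z \<le> snd z then 1 else 0 :: real) = (\<lambda>(s, r). indicator {s..} r)"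
      by (auto simp: fun_eq_iff)
    finally show ?thesis .
  qed
  note fub = Fubini_bounded_kernel[OF sf sf fN gN K, of 1]
  have inner1: "(\<integral>r. indicator {s..} r * g r \<partial>?N) = integral {s..T} g" if s: "s \<in> {0..T}" for s
  proof -
    have "(\<integral>r. indicator {s..} r * g r \<partial>?N) = integral {0..T} (\<lambda>r. indicator {s..} r * g r)"
      by (intro lebesgue_integral_eq_integral Bochner_Integration.integrable_bound[OF gN])
        (auto split: split_indicator)
    also have "\<dots> = integral {0..T} (\<lambda>r. if r \<in> {s..} then g r else 0)"
      by (intro arg_cong[of _ _ "integral _"]) (auto split: split_indicator)
    also have "\<dots> = integral ({s..} \<inter> {0..T}) g" by (rule integral_restrict_Int)
    also have "{s..} \<inter> {0..T} = {s..T}" using s by auto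
    finally show ?thesis .
  qed
  have inner2: "(\<integral>s. f s * indicator {s..} r \<partial>?N) = integral {0..r} f" if r: "r \<in> {0..T}" for r
  proof -
    have "(\<integral>s. f s * indicator {s..} r \<partial>?N) = (\<integral>s. f s * indicator {..r} s \<partial>?N)"
      by (intro Bochner_Integration.integral_cong refl) (auto split: split_indicator)
    also have "\<dots> = integral {0..T} (\<lambda>s. f s * indicator {..r} s)"
      by (intro lebesgue_integral_eq_integral Bochner_Integration.integrable_bound[OF fN])
        (auto split: split_indicator)
    also have "\<dots> = integral {0..T} (\<lambda>s. if s \<in> {..r} then f s else 0)"
      by (intro arg_cong[of _ _ "integral _"]) (auto split: split_indicator)
    also have "\<dots> = integral ({..r} \<inter> {0..T}) f" by (rule integral_restrict_Int)
    also have "{..r} \<inter> {0..T} = {0..r}" using r by auto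
    finally show ?thesis .
  qed
  have "(\<integral>s. f s * integral {s..T} g \<partial>?N) = (\<integral>s. f s * (\<integral>r. indicator {s..} r * g r \<partial>?N) \<partial>?N)"
    by (intro Bochner_Integration.integral_cong refl) (simp add: inner1)
  also have "\<dots> = (\<integral>r. (\<integral>s. f s * indicator {s..} r \<partial>?N) * g r \<partial>?N)"
    by (rule fub(3)) (auto split: split_indicator)
  also have "\<dots> = (\<integral>r. integral {0..r} f * g r \<partial>?N)"
    by (intro Bochner_Integration.integral_cong refl) (simp add: inner2)
  finally have eq: "(\<integral>s. f s * integral {s..T} g \<partial>?N) = (\<integral>r. integral {0..r} f * g r \<partial>?N)" .
  have "continuous_on {0..T} (\<lambda>s. integral {s..T} g)" "continuous_on {0..T} (\<lambda>r. integral {0..r} f)"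
    using set_lebesgue_integral_eq_integral(1)[OF f] set_lebesgue_integral_eq_integral(1)[OF g]
    by (auto intro: indefinite_integral_continuous_1 indefinite_integral_continuous_1')
  from absolutely_integrable_continuous_mult[OF this(1) f]
    absolutely_integrable_continuous_mult[OF this(2) g]
  have "integrable ?N (\<lambda>s. f s * integral {s..T} g)" "integrable ?N (\<lambda>r. integral {0..r} f * g r)"
    by (auto simp: mult.commute absolutely_integrable_imp_integrable)
  then show ?thesis using eq by (simp add: lebesgue_integral_eq_integral)
qed

text \<open>Variation of constants with an integrable but possibly discontinuous forcing
\<open>h\<close>. The solution is then only absolutely continuous and the integrating factor
cannot be differentiated against it. Subtracting the primitive of \<open>h\<close> leaves a
continuously differentiable function, to which \<open>linear_ode_terminal\<close> applies; the
term this produces is turned back into an integral against \<open>h\<close> by Fubini's theorem on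
the triangle \<open>s \<le> r\<close>.\<close>

lemma linear_ode_terminal_rough:
  fixes d a r h :: "real \<Rightarrow> real"
  assumes T: "0 \<le> T"
    and cont: "continuous_on {0..T} d" "continuous_on {0..T} a" "continuous_on {0..T} r"
    and h: "h absolutely_integrable_on {0..T}"
    and d: "\<And>t. t \<in> {0..T} \<Longrightarrow> d t = integral {0..t} (\<lambda>s. a s * d s + r s) + integral {0..t} h"
  shows "d T = integral {0..T} (\<lambda>s. exp (integral {s..T} a) * r s)
      + integral {0..T} (\<lambda>s. exp (integral {s..T} a) * h s)"
proof -
  let ?E = "\<lambda>s. exp (integral {s..T} a)" and ?H = "\<lambda>t. integral {0..t} h"
  have hi: "h integrable_on {0..T}" using set_lebesgue_integral_eq_integral(1)[OF h] .
  have cH: "continuous_on {0..T} ?H" by (rule indefinite_integral_continuous_1[OF hi])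
  have cE: "continuous_on {0..T} ?E"
    using integrable_continuous_real[OF cont(2)]
    by (intro continuous_intros indefinite_integral_continuous_1')
  have cEaH: "continuous_on {0..T} (\<lambda>s. ?E s * a s)" by (intro continuous_intros cE cont)
  have "d T - ?H T = integral {0..T} (\<lambda>s. ?E s * (a s * ?H s + r s))"
  proof (rule linear_ode_terminal[OF T])
    fix t assume "t \<in> {0..T}"
    then show "d t - ?H t = integral {0..t} (\<lambda>s. a s * (d s - ?H s) + (a s * ?H s + r s))"
      using d[of t] by (simp add: algebra_simps)
  qed (intro continuous_intros cont cH)+
  also have "\<dots> = integral {0..T} (\<lambda>s. ?H s * (?E s * a s) + ?E s * r s)"
    by (simp add: algebra_simps)
  also have "\<dots> = integral {0..T} (\<lambda>s. ?H s * (?E s * a s)) + integral {0..T} (\<lambda>s. ?E s * r s)"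
    by (intro integral_add integrable_continuous_real continuous_intros cH cE cont)
  also have "integral {0..T} (\<lambda>s. ?H s * (?E s * a s))
      = integral {0..T} (\<lambda>s. h s * integral {s..T} (\<lambda>r. ?E r * a r))"
    by (rule integral_swap_triangle[OF h, symmetric])
      (rule absolutely_integrable_continuous_real[OF cEaH])
  also have "\<dots> = integral {0..T} (\<lambda>s. ?E s * h s - h s)"
  proof (rule Henstock_Kurzweil_Integration.integral_cong)
    fix s assume s: "s \<in> {0..T}"
    have "((\<lambda>r. - ?E r) has_real_derivative ?E r * a r) (at r within {s..T})" if "r \<in> {s..T}" for r
    proof -
      have "((\<lambda>s. integral {s..T} a) has_real_derivative - a r) (at r within {s..T})"
        using that s by (intro integral_has_real_derivative' continuous_on_subset[OF cont(2)]) auto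
      then show ?thesis by (auto intro!: derivative_eq_intros simp: algebra_simps)
    qed
    then have "((\<lambda>r. ?E r * a r) has_integral (- ?E T - (- ?E s))) {s..T}"
      using s by (intro fundamental_theorem_of_calculus)
        (auto simp: has_real_derivative_iff_has_vector_derivative)
    then have "integral {s..T} (\<lambda>r. ?E r * a r) = ?E s - 1" by (simp add: integral_unique)
    then show "h s * integral {s..T} (\<lambda>r. ?E r * a r) = ?E s * h s - h s"
      by (simp only:) (simp add: algebra_simps)
  qed
  also have "\<dots> = integral {0..T} (\<lambda>s. ?E s * h s) - ?H T"
  proof (rule Henstock_Kurzweil_Integration.integral_diff[OF _ hi])
    show "(\<lambda>s. ?E s * h s) integrable_on {0..T}"
      using set_lebesgue_integral_eq_integral(1)[OF absolutely_integrable_continuous_mult[OF cE h]] .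
  qed
  finally show ?thesis by simp
qed

text \<open>The derivative of the terminal state with respect to a unit impulse applied at time
\<open>s\<close>: the solution at \<open>T\<close> of the linearised equation along
\<open>x\<close>, started from \<open>1\<close> at \<open>s\<close>.\<close>

definition sensitivity :: "(real \<Rightarrow> real) \<Rightarrow> real \<Rightarrow> real \<Rightarrow> real" where
  "sensitivity x T s = exp (integral {s..T} (\<lambda>r. drift' (x r)))"

lemma sensitivity_bounds:
  assumes x: "continuous_on {0..T} x" and s: "s \<in> {0..T}"
  shows "1 \<le> sensitivity x T s" "sensitivity x T s \<le> exp (T - s)"
proof -
  have c: "continuous_on {s..T} (\<lambda>r. drift' (x r))"
    by (rule continuous_on_compose2[OF continuous_on_drift' continuous_on_subset[OF x]]) (use s in auto)
  have i: "(\<lambda>r. drift' (x r)) integrable_on {s..T}"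
    by (rule integrable_continuous_real[OF c])
  show "1 \<le> sensitivity x T s"
    using integral_nonneg[OF i] by (simp add: sensitivity_def drift'_nonneg)
  have "integral {s..T} (\<lambda>r. drift' (x r)) \<le> integral {s..T} (\<lambda>r. 1)"
    by (intro integral_le i) (auto simp: drift'_le_one)
  then show "sensitivity x T s \<le> exp (T - s)" using s by (simp add: sensitivity_def)
qed

lemma continuous_on_sensitivity:
  assumes x: "continuous_on {0..T} x"
  shows "continuous_on {0..T} (sensitivity x T)"
proof -
  have "continuous_on {0..T} (\<lambda>r. drift' (x r))"
    by (rule continuous_on_compose2[OF continuous_on_drift' x]) auto
  then show ?thesis unfolding sensitivity_def
    by (intro continuous_intros indefinite_integral_continuous_1' integrable_continuous_real)
qed

text \<open>The noise is additive, so it cancels in \<open>d = y - x\<close>, which solves a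
random ordinary differential equation. Gronwall's inequality bounds \<open>d\<close> by a multiple
of \<open>\<delta>\<close>; hence the Taylor remainder of the drift along \<open>d\<close> is of
order \<open>\<delta>\<^sup>2\<close>, and \<open>d\<close> solves the linearised equation up to
that remainder. The constants depend on \<open>h\<close> and \<open>T\<close> but not on the
paths, so the estimates survive taking expectations without any domination argument.\<close>

lemma path_perturbation:
  fixes x y w h :: "real \<Rightarrow> real"
  assumes T: "0 \<le> T" and h: "h absolutely_integrable_on {0..T}"
    and cont: "continuous_on {0..T} x" "continuous_on {0..T} y"
    and x: "\<And>t. t \<in> {0..T} \<Longrightarrow> x t = integral {0..t} (\<lambda>s. drift (x s)) + w t"
    and y: "\<And>t. t \<in> {0..T} \<Longrightarrow>
      y t = integral {0..t} (\<lambda>s. drift (y s)) + \<delta> * integral {0..t} h + w t"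
  defines "C \<equiv> integral {0..T} (\<lambda>s. \<bar>h s\<bar>) * exp T"
  shows "\<bar>y T - x T\<bar> \<le> \<bar>\<delta>\<bar> * C"
    and "\<bar>y T - x T - \<delta> * integral {0..T} (\<lambda>s. sensitivity x T s * h s)\<bar> \<le> \<delta>\<^sup>2 * (C\<^sup>2 * T * exp T)"
proof -
  define d where "d t = y t - x t" for t
  define r where "r s = drift (y s) - drift (x s) - drift' (x s) * d s" for s
  let ?L = "integral {0..T} (\<lambda>s. \<bar>h s\<bar>)"
  have cd: "continuous_on {0..T} d" unfolding d_def by (intro continuous_intros cont)
  have cb: "continuous_on {0..T} (\<lambda>s. drift (x s))" "continuous_on {0..T} (\<lambda>s. drift (y s))"
      "continuous_on {0..T} (\<lambda>s. drift' (x s))"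
    by (auto intro: continuous_on_compose2[OF continuous_on_drift cont(1)]
        continuous_on_compose2[OF continuous_on_drift cont(2)]
        continuous_on_compose2[OF continuous_on_drift' cont(1)])
  have cr: "continuous_on {0..T} r" unfolding r_def by (intro continuous_intros cb cd)
  have hi: "h integrable_on {0..T}" "(\<lambda>s. \<bar>h s\<bar>) integrable_on {0..T}"
    using h absolutely_integrable_abs[OF h] by (auto dest: set_lebesgue_integral_eq_integral(1))
  have deq: "d t = integral {0..t} (\<lambda>s. drift (y s) - drift (x s)) + \<delta> * integral {0..t} h"
    if t: "t \<in> {0..T}" for t
  proof -
    have "{0..t} \<subseteq> {0..T}" using t by auto
    then have "integral {0..t} (\<lambda>s. drift (y s) - drift (x s))
        = integral {0..t} (\<lambda>s. drift (y s)) - integral {0..t} (\<lambda>s. drift (x s))"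
      by (intro Henstock_Kurzweil_Integration.integral_diff integrable_continuous_real
          continuous_on_subset[OF cb(1)] continuous_on_subset[OF cb(2)])
    then show ?thesis using x[OF t] y[OF t] by (simp add: d_def)
  qed
  have dle: "\<bar>d t\<bar> \<le> \<bar>\<delta>\<bar> * C" if t: "t \<in> {0..T}" for t
  proof -
    have "\<bar>d t\<bar> \<le> \<bar>\<delta>\<bar> * ?L * exp t"
    proof (rule gronwall[OF _ _ t])
      fix t assume t: "t \<in> {0..T}"
      then have sub: "{0..t} \<subseteq> {0..T}" by auto
      have "\<bar>integral {0..t} (\<lambda>s. drift (y s) - drift (x s))\<bar> \<le> integral {0..t} (\<lambda>s. \<bar>d s\<bar>)"
        unfolding real_norm_def[symmetric]
        by (intro integral_norm_bound_integral integrable_continuous_real continuous_intros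
            continuous_on_subset[OF cb(1) sub] continuous_on_subset[OF cb(2) sub]
            continuous_on_subset[OF cd sub]) (simp add: d_def drift_lipschitz)
      moreover have "\<bar>integral {0..t} h\<bar> \<le> ?L"
      proof -
        have "\<bar>integral {0..t} h\<bar> \<le> integral {0..t} (\<lambda>s. \<bar>h s\<bar>)"
          unfolding real_norm_def[symmetric]
          by (intro integral_norm_bound_integral integrable_on_subinterval[OF hi(1)] 
              integrable_on_subinterval[OF hi(2), unfolded real_norm_def[symmetric]] sub) auto
        also have "\<dots> \<le> ?L"
          by (intro integral_subset_le sub hi integrable_on_subinterval[OF hi(2)]) auto
        finally show ?thesis .
      qed
      then have "\<bar>\<delta> * integral {0..t} h\<bar> \<le> \<bar>\<delta>\<bar> * ?L" by (simp add: abs_mult mult_left_mono)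
      ultimately show "\<bar>d t\<bar> \<le> \<bar>\<delta>\<bar> * ?L + integral {0..t} (\<lambda>s. \<bar>d s\<bar>)"
        using deq[OF t] by linarith
    qed (intro continuous_intros cd)
    also have "\<dots> \<le> \<bar>\<delta>\<bar> * ?L * exp T"
      using t by (intro mult_left_mono mult_nonneg_nonneg integral_nonneg hi) auto
    finally show ?thesis by (simp add: C_def mult.assoc)
  qed
  then show "\<bar>y T - x T\<bar> \<le> \<bar>\<delta>\<bar> * C" using T by (simp add: d_def)
  have \<delta>h: "(\<lambda>s. \<delta> * h s) absolutely_integrable_on {0..T}" using h by simp
  have "d T = integral {0..T} (\<lambda>s. sensitivity x T s * r s)
      + integral {0..T} (\<lambda>s. sensitivity x T s * (\<delta> * h s))"
    unfolding sensitivity_def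
    by (rule linear_ode_terminal_rough[OF T cd cb(3) cr \<delta>h]) (use deq in \<open>auto simp: r_def\<close>)
  also have "integral {0..T} (\<lambda>s. sensitivity x T s * (\<delta> * h s))
      = \<delta> * integral {0..T} (\<lambda>s. sensitivity x T s * h s)"
    by (simp add: mult.left_commute)
  finally have "\<bar>d T - \<delta> * integral {0..T} (\<lambda>s. sensitivity x T s * h s)\<bar>
      = \<bar>integral {0..T} (\<lambda>s. sensitivity x T s * r s)\<bar>" by simp
  also have "\<dots> \<le> exp T * (\<bar>\<delta>\<bar> * C)\<^sup>2 * (T - 0)"
    unfolding real_norm_def[symmetric]
  proof (rule integral_bound[OF T])
    show "continuous_on {0..T} (\<lambda>s. sensitivity x T s * r s)"
      by (intro continuous_intros continuous_on_sensitivity cont cr)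
    fix s assume s: "s \<in> {0..T}"
    have "\<bar>r s\<bar> \<le> (d s)\<^sup>2" unfolding r_def d_def by (rule drift_taylor)
    also have "\<dots> \<le> (\<bar>\<delta>\<bar> * C)\<^sup>2" using power_mono[OF dle[OF s], of 2] by simp
    finally have "\<bar>r s\<bar> \<le> (\<bar>\<delta>\<bar> * C)\<^sup>2" .
    moreover have "\<bar>sensitivity x T s\<bar> \<le> exp T"
    proof -
      have "exp (T - s) \<le> exp T" using s by simp
      then show ?thesis using sensitivity_bounds[OF cont(1) s] by linarith
    qed
    ultimately show "norm (sensitivity x T s * r s) \<le> exp T * (norm \<delta> * C)\<^sup>2"
      by (simp add: abs_mult mult_mono)
  qed
  also have "\<dots> = \<delta>\<^sup>2 * (C\<^sup>2 * T * exp T)" by (simp add: power_mult_distrib)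
  finally show "\<bar>y T - x T - \<delta> * integral {0..T} (\<lambda>s. sensitivity x T s * h s)\<bar>
      \<le> \<delta>\<^sup>2 * (C\<^sup>2 * T * exp T)" by (simp add: d_def)
qed

section \<open>Measurability and moments\<close>

text \<open>A process with continuous paths is the pointwise limit of its discretisations along
the grids of mesh \<open>1 / Suc n\<close>, each of which takes only countably many times into
account.\<close>

lemma borel_measurable_pair_if_continuous:
  fixes f :: "real \<Rightarrow> 'a \<Rightarrow> real"
  assumes meas: "\<And>s. f s \<in> borel_measurable M"
    and cont: "\<And>\<omega>. \<omega> \<in> space M \<Longrightarrow> continuous_on UNIV (\<lambda>s. f s \<omega>)"
  shows "(\<lambda>(\<omega>, s). f s \<omega>) \<in> borel_measurable (M \<Otimes>\<^sub>M borel)"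
proof -
  define q where "q n s = of_int \<lfloor>real (Suc n) * s\<rfloor> / real (Suc n)" for n and s :: real
  have q: "(\<lambda>n. q n s) \<longlonglongrightarrow> s" for s
  proof (rule LIMSEQ_I)
    fix e :: real assume "0 < e"
    then obtain m where m: "inverse (real (Suc m)) < e" using reals_Archimedean by blast
    have "norm (q n s - s) < e" if "m \<le> n" for n
    proof -
      have "\<bar>real_of_int \<lfloor>real (Suc n) * s\<rfloor> - real (Suc n) * s\<bar> \<le> 1"
        using floor_correct[of "real (Suc n) * s"] by linarith
      moreover have "q n s - s = (real_of_int \<lfloor>real (Suc n) * s\<rfloor> - real (Suc n) * s) / real (Suc n)"
        unfolding q_def diff_divide_distrib by simp
      ultimately have "\<bar>q n s - s\<bar> \<le> 1 / real (Suc n)"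
        by (simp only: abs_divide abs_of_nat) (rule divide_right_mono, auto)
      then have "\<bar>q n s - s\<bar> \<le> inverse (real (Suc n))" by (simp only: inverse_eq_divide)
      also have "\<dots> \<le> inverse (real (Suc m))" using that by (simp add: le_imp_inverse_le)
      finally show ?thesis using m by simp
    qed
    then show "\<exists>m. \<forall>n\<ge>m. norm (q n s - s) < e" by blast
  qed
  show ?thesis
  proof (rule borel_measurable_LIMSEQ_real)
    show "(\<lambda>n. f (q n (snd z)) (fst z)) \<longlonglongrightarrow> (case z of (\<omega>, s) \<Rightarrow> f s \<omega>)"
      if "z \<in> space (M \<Otimes>\<^sub>M borel)" for z
      using continuous_on_tendsto_compose[OF cont[of "fst z"] q[of "snd z"]] that
      by (auto simp: space_pair_measure)
    show "(\<lambda>z. f (q n (snd z)) (fst z)) \<in> borel_measurable (M \<Otimes>\<^sub>M borel)" for n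
      unfolding q_def
      by (rule measurable_compose_countable[where f = "\<lambda>i z. f (of_int i / real (Suc n)) (fst z)"])
        (use meas in measurable)
  qed
qed

text \<open>The state process has continuous paths only almost surely and is constrained only on
\<open>[0,T]\<close>. Setting it to zero on a null set and freezing it outside
\<open>[0,T]\<close> gives everywhere continuous paths, as needed for joint measurability.\<close>

lemma regular_version:
  fixes u :: "real \<Rightarrow> 'a \<Rightarrow> real"
  assumes T: "0 \<le> T" and meas: "\<And>t. t \<in> {0..T} \<Longrightarrow> u t \<in> borel_measurable M"
    and cont: "AE \<omega> in M. continuous_on {0..T} (\<lambda>t. u t \<omega>)"
  obtains v where "\<And>s. v s \<in> borel_measurable M" "\<And>\<omega>. continuous_on UNIV (\<lambda>s. v s \<omega>)"
    "AE \<omega> in M. \<forall>t\<in>{0..T}. v t \<omega> = u t \<omega>"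
proof -
  obtain N where N: "{\<omega> \<in> space M. \<not> continuous_on {0..T} (\<lambda>t. u t \<omega>)} \<subseteq> N"
      "emeasure M N = 0" "N \<in> sets M"
    using AE_E[OF cont] by blast
  define v where "v s \<omega> = (if \<omega> \<in> space M - N then u (max 0 (min T s)) \<omega> else 0)" for s \<omega>
  show ?thesis
  proof (rule that)
    show "v s \<in> borel_measurable M" for s
      unfolding v_def using N(3) T by (intro measurable_If_set meas) auto
    show "continuous_on UNIV (\<lambda>s. v s \<omega>)" for \<omega>
    proof (cases "\<omega> \<in> space M - N")
      case True
      then have "continuous_on {0..T} (\<lambda>t. u t \<omega>)" using N(1) by auto
      then have "continuous_on UNIV (\<lambda>s. u (max 0 (min T s)) \<omega>)"
        by (rule continuous_on_compose2) (use T in \<open>auto intro!: continuous_intros\<close>)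
      then show ?thesis using True by (simp add: v_def)
    next
      case False
      then have zero: "(\<lambda>s. v s \<omega>) = (\<lambda>_. 0)" by (auto simp: v_def)
      show ?thesis unfolding zero by (rule continuous_on_const)
    qed
    have "AE \<omega> in M. \<omega> \<notin> N" using N by (intro AE_not_in) (auto intro: null_setsI)
    with AE_space show "AE \<omega> in M. \<forall>t\<in>{0..T}. v t \<omega> = u t \<omega>"
      by eventually_elim (auto simp: v_def)
  qed
qed

lemma sensitivity_measurable:
  assumes v: "\<And>s. v s \<in> borel_measurable M" "\<And>\<omega>. continuous_on UNIV (\<lambda>s. v s \<omega>)"
  shows "(\<lambda>(\<omega>, s). sensitivity (\<lambda>r. v r \<omega>) T s) \<in> borel_measurable (M \<Otimes>\<^sub>M lebesgue_on {0..T})"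
proof -
  let ?P = "M \<Otimes>\<^sub>M lebesgue_on {0..T}"
  have [measurable]: "(\<lambda>x. x) \<in> borel_measurable (lebesgue_on {0..T})"
    by (auto intro!: measurable_restrict_space1 measurable_completion)
  have "(\<lambda>z. (fst (fst z), snd z)) \<in> (?P \<Otimes>\<^sub>M lborel) \<rightarrow>\<^sub>M (M \<Otimes>\<^sub>M borel)" by measurable
  from measurable_compose[OF this borel_measurable_pair_if_continuous[OF v]]
  have [measurable]: "(\<lambda>z. v (snd z) (fst (fst z))) \<in> borel_measurable (?P \<Otimes>\<^sub>M lborel)" by simp
  have [measurable]: "drift' \<in> borel_measurable borel"
    by (rule borel_measurable_continuous_onI[OF continuous_on_drift'])
  have "(\<lambda>z. (if snd (fst z) \<le> snd z \<and> snd z \<le> T then 1 else 0) * drift' (v (snd z) (fst (fst z))))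
      \<in> borel_measurable (?P \<Otimes>\<^sub>M lborel)" by measurable
  then have "(\<lambda>p. \<integral>r. (if snd p \<le> r \<and> r \<le> T then 1 else 0) * drift' (v r (fst p)) \<partial>lborel)
      \<in> borel_measurable ?P"
    by (intro lborel.borel_measurable_lebesgue_integral) (simp add: split_def)
  moreover have "(\<integral>r. (if s \<le> r \<and> r \<le> T then 1 else 0) * drift' (v r \<omega>) \<partial>lborel)
      = integral {s..T} (\<lambda>r. drift' (v r \<omega>))" for \<omega> s
  proof -
    have "continuous_on {s..T} (\<lambda>r. drift' (v r \<omega>))"
      by (rule continuous_on_compose2[OF continuous_on_drift' continuous_on_subset[OF v(2)]]) auto
    then have "set_integrable lborel {s..T} (\<lambda>r. drift' (v r \<omega>))"
      by (rule borel_integrable_atLeastAtMost')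
    from set_borel_integral_eq_integral(2)[OF this, symmetric]
    show ?thesis unfolding set_lebesgue_integral_def
      by (auto intro!: Bochner_Integration.integral_cong split: split_indicator)
  qed
  ultimately have "(\<lambda>p. exp (integral {snd p..T} (\<lambda>r. drift' (v r (fst p))))) \<in> borel_measurable ?P"
    by simp
  then show ?thesis by (simp add: sensitivity_def split_def)
qed

text \<open>With \<open>d = X' - X\<close>, the increment of half the square is \<open>X * d +
d\<^sup>2 / 2\<close>, and \<open>d\<close> is \<open>\<delta> * Y\<close> up to order
\<open>\<delta>\<^sup>2\<close>. Here \<open>Y\<close> stands for the response of the terminal
state to the perturbation.\<close>

lemma (in prob_space) second_moment_expansion:
  fixes X X' Y :: "'a \<Rightarrow> real"
  assumes [measurable]: "X \<in> borel_measurable M" "X' \<in> borel_measurable M"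
    and X2: "integrable M (\<lambda>\<omega>. (X \<omega>)\<^sup>2)" and XY: "integrable M (\<lambda>\<omega>. X \<omega> * Y \<omega>)"
    and D: "AE \<omega> in M. \<bar>X' \<omega> - X \<omega>\<bar> \<le> \<bar>\<delta>\<bar> * C"
    and R: "AE \<omega> in M. \<bar>X' \<omega> - X \<omega> - \<delta> * Y \<omega>\<bar> \<le> \<delta>\<^sup>2 * K"
  shows "\<bar>expectation (\<lambda>\<omega>. 1/2 * (X' \<omega>)\<^sup>2) - expectation (\<lambda>\<omega>. 1/2 * (X \<omega>)\<^sup>2)
      - \<delta> * expectation (\<lambda>\<omega>. X \<omega> * Y \<omega>)\<bar> \<le> \<delta>\<^sup>2 * (K * expectation (\<lambda>\<omega>. \<bar>X \<omega>\<bar>) + C\<^sup>2 / 2)"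
proof -
  have X1: "integrable M X" by (rule square_integrable_imp_integrable[OF _ X2]) simp
  have X'2: "integrable M (\<lambda>\<omega>. (X' \<omega>)\<^sup>2)"
  proof (rule Bochner_Integration.integrable_bound)
    show "integrable M (\<lambda>\<omega>. 2 * (X \<omega>)\<^sup>2 + 2 * (\<bar>\<delta>\<bar> * C)\<^sup>2)" using X2 by simp
    show "AE \<omega> in M. norm ((X' \<omega>)\<^sup>2) \<le> norm (2 * (X \<omega>)\<^sup>2 + 2 * (\<bar>\<delta>\<bar> * C)\<^sup>2)"
      using D
    proof eventually_elim
      case (elim \<omega>)
      define d where "d = X' \<omega> - X \<omega>"
      have "d\<^sup>2 \<le> (\<bar>\<delta>\<bar> * C)\<^sup>2" using power_mono[OF elim, of 2] by (simp add: d_def)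
      moreover have "(X' \<omega>)\<^sup>2 \<le> 2 * (X \<omega>)\<^sup>2 + 2 * d\<^sup>2"
        using zero_le_power2[of "X \<omega> - d"] unfolding d_def by (simp add: power2_eq_square algebra_simps)
      ultimately show ?case by simp
    qed
  qed measurable
  have "expectation (\<lambda>\<omega>. 1/2 * (X' \<omega>)\<^sup>2) - expectation (\<lambda>\<omega>. 1/2 * (X \<omega>)\<^sup>2)
      - \<delta> * expectation (\<lambda>\<omega>. X \<omega> * Y \<omega>)
    = expectation (\<lambda>\<omega>. 1/2 * (X' \<omega>)\<^sup>2 - 1/2 * (X \<omega>)\<^sup>2 - \<delta> * (X \<omega> * Y \<omega>))" (is "?l = ?r")
    using X2 X'2 XY by simp
  then have "\<bar>?l\<bar> = \<bar>?r\<bar>" by (rule arg_cong)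
  also have "\<dots> \<le> expectation (\<lambda>\<omega>. \<bar>1/2 * (X' \<omega>)\<^sup>2 - 1/2 * (X \<omega>)\<^sup>2 - \<delta> * (X \<omega> * Y \<omega>)\<bar>)"
    by (rule integral_abs_bound)
  also have "\<dots> \<le> expectation (\<lambda>\<omega>. \<delta>\<^sup>2 * K * \<bar>X \<omega>\<bar> + \<delta>\<^sup>2 * C\<^sup>2 / 2)"
  proof (rule integral_mono_AE)
    show "AE \<omega> in M. \<bar>1/2 * (X' \<omega>)\<^sup>2 - 1/2 * (X \<omega>)\<^sup>2 - \<delta> * (X \<omega> * Y \<omega>)\<bar>
        \<le> \<delta>\<^sup>2 * K * \<bar>X \<omega>\<bar> + \<delta>\<^sup>2 * C\<^sup>2 / 2"
      using D R
    proof eventually_elim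
      case (elim \<omega>)
      define d where "d = X' \<omega> - X \<omega>"
      have "1/2 * (X' \<omega>)\<^sup>2 - 1/2 * (X \<omega>)\<^sup>2 - \<delta> * (X \<omega> * Y \<omega>) = X \<omega> * (d - \<delta> * Y \<omega>) + d\<^sup>2 / 2"
        (is "?e = ?f") unfolding d_def by (simp add: power2_eq_square algebra_simps add_divide_distrib diff_divide_distrib)
      then have "\<bar>?e\<bar> = \<bar>?f\<bar>" by (rule arg_cong)
      also have "\<dots> \<le> \<bar>X \<omega>\<bar> * \<bar>d - \<delta> * Y \<omega>\<bar> + d\<^sup>2 / 2"
        by (rule order_trans[OF abs_triangle_ineq]) (simp add: abs_mult)
      also have "\<dots> \<le> \<bar>X \<omega>\<bar> * (\<delta>\<^sup>2 * K) + \<delta>\<^sup>2 * C\<^sup>2 / 2"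
        using mult_left_mono[OF elim(2), of "\<bar>X \<omega>\<bar>"] power_mono[OF elim(1), of 2]
        by (simp add: d_def power_mult_distrib)
      finally show ?case by (simp add: mult_ac)
    qed
  qed (use X1 X2 X'2 XY in simp_all)
  also have "\<dots> = \<delta>\<^sup>2 * (K * expectation (\<lambda>\<omega>. \<bar>X \<omega>\<bar>) + C\<^sup>2 / 2)"
    using X1 by (simp add: prob_space algebra_simps)
  finally show ?thesis .
qed

lemma (in prob_space) brownian_motion_moments:
  assumes B: "brownian_motion M B" and T: "0 < T"
  shows "integrable M (B T)" "integrable M (\<lambda>\<omega>. (B T \<omega>)\<^sup>2)"
    "expectation (B T) = 0" "\<not> (AE \<omega> in M. B T \<omega> \<le> 0)"
proof -
  define X where "X \<omega> = B T \<omega> - B 0 \<omega>" for \<omega>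
  have D: "distributed M lborel X (normal_density 0 (sqrt T))"
    and [measurable]: "B T \<in> borel_measurable M" "B 0 \<in> borel_measurable M"
    and ae: "AE \<omega> in M. X \<omega> = B T \<omega>"
    using B T unfolding brownian_motion_def X_def by auto
  have [measurable]: "X \<in> borel_measurable M" unfolding X_def[abs_def] by measurable
  have sT: "0 < sqrt T" using T by simp
  have m: "integrable M (\<lambda>\<omega>. X \<omega> ^ k)" for k
    using integrable_normal_moment[OF sT, of 0 k] distributed_integrable[OF D, of "\<lambda>x. x ^ k"] by simp
  have e: "expectation X = 0" by (rule normal_distributed_expectation[OF sT D])
  have var: "expectation (\<lambda>\<omega>. (X \<omega>)\<^sup>2) = T"
    using normal_distributed_variance[OF sT D] T by (simp add: e)
  show i: "integrable M (B T)"
    using m[of 1] by (rule Bochner_Integration.integrable_cong_AE_imp) (use ae in auto)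
  show "integrable M (\<lambda>\<omega>. (B T \<omega>)\<^sup>2)"
    using m[of 2] by (rule Bochner_Integration.integrable_cong_AE_imp) (use ae in auto)
  have "expectation (B T) = expectation X" by (rule integral_cong_AE) (use ae in auto)
  with e show e0: "expectation (B T) = 0" by simp
  show "\<not> (AE \<omega> in M. B T \<omega> \<le> 0)"
  proof
    assume "AE \<omega> in M. B T \<omega> \<le> 0"
    then have "AE \<omega> in M. - B T \<omega> = 0"
      using integral_nonneg_eq_0_iff_AE[of M "\<lambda>\<omega>. - B T \<omega>"] i e0 by simp
    with ae have "AE \<omega> in M. (X \<omega>)\<^sup>2 = 0" by eventually_elim simp
    then have "expectation (\<lambda>\<omega>. (X \<omega>)\<^sup>2) = 0" by (rule integral_eq_zero_AE)
    with var T show False by simp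
  qed
qed

section \<open>Controls and state processes\<close>

text \<open>Constants are integrable on a bounded interval, and \<open>\<bar>g t\<bar> \<le> 1 +
\<bar>g t\<bar> ^ 6\<close>; integrability is all that the estimates use of a control.\<close>

lemma L6_imp_absolutely_integrable:
  assumes "g \<in> L6 T" shows "g absolutely_integrable_on {0..T}"
proof -
  have g: "set_borel_measurable lebesgue {0..T} g" "(\<lambda>t. \<bar>g t\<bar> ^ 6) absolutely_integrable_on {0..T}"
    using assms by (auto simp: L6_def)
  have "(\<lambda>t. 1 + \<bar>g t\<bar> ^ 6) absolutely_integrable_on {0..T}"
    by (intro set_integral_add g absolutely_integrable_continuous_real continuous_intros)
  then show ?thesis
  proof (rule set_integrable_bound[OF _ g(1)], intro AE_I2 impI)
    fix t
    show "norm (g t) \<le> norm (1 + \<bar>g t\<bar> ^ 6)"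
    proof (cases "\<bar>g t\<bar> \<le> 1")
      case False
      then have "\<bar>g t\<bar> \<le> \<bar>g t\<bar> ^ 6" by (intro self_le_power) auto
      then show ?thesis by simp
    qed (simp add: add_increasing2)
  qed
qed

lemma L6_scale: "g \<in> L6 T \<Longrightarrow> (\<lambda>t. c * g t) \<in> L6 T"
  by (auto simp: L6_def set_borel_measurable_def abs_mult power_mult_distrib
      mult.left_commute[of _ c])

lemma L6_zero: "(\<lambda>_. 0) \<in> L6 T"
  by (simp add: L6_def set_borel_measurable_def)

lemma L6_indicator: "(indicator {a..b} :: real \<Rightarrow> real) \<in> L6 T"
proof -
  have [measurable]: "indicator {a..b} \<in> borel_measurable lebesgue" "indicator {0..T} \<in> borel_measurable lebesgue"
    by (auto intro!: borel_measurable_indicator)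
  have "integrable lebesgue (indicator ({0..T} \<inter> {a..b}) :: real \<Rightarrow> real)"
    by (rule integrable_real_indicator) (auto simp: emeasure_lborel_Icc_eq)
  also have "indicator ({0..T} \<inter> {a..b}) = (\<lambda>t. indicator {0..T} t *\<^sub>R \<bar>indicator {a..b} t :: real\<bar> ^ 6)"
    by (auto simp: fun_eq_iff split: split_indicator)
  finally show ?thesis by (auto simp: L6_def set_borel_measurable_def set_integrable_def)
qed

lemma sde_solution_paths:
  assumes u: "sde_solution M B \<sigma> T g u" and g: "g absolutely_integrable_on {0..T}"
  shows "AE \<omega> in M. continuous_on {0..T} (\<lambda>t. u t \<omega>) \<and>
    (\<forall>t\<in>{0..T}. u t \<omega> = integral {0..t} (\<lambda>s. drift (u s \<omega>)) + integral {0..t} g + \<sigma> * B t \<omega>)"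
proof -
  have "AE \<omega> in M. continuous_on {0..T} (\<lambda>t. u t \<omega>) \<and> (\<forall>t\<in>{0..T}. u t \<omega> =
           (LINT s:{0..t}|lebesgue. - deriv V (u s \<omega>) + g s) + \<sigma> * B t \<omega>)"
    using u by (simp add: sde_solution_def)
  then show ?thesis
  proof eventually_elim
    case (elim \<omega>)
    have "(LINT s:{0..t}|lebesgue. - deriv V (u s \<omega>) + g s)
        = integral {0..t} (\<lambda>s. drift (u s \<omega>)) + integral {0..t} g" if t: "t \<in> {0..T}" for t
    proof -
      have "continuous_on {0..t} (\<lambda>s. drift (u s \<omega>))"
        by (rule continuous_on_compose2[OF continuous_on_drift continuous_on_subset[OF conjunct1[OF elim]]])
          (use t in auto)
      then have 1: "(\<lambda>s. drift (u s \<omega>)) absolutely_integrable_on {0..t}"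
        by (rule absolutely_integrable_continuous_real)
      have 2: "g absolutely_integrable_on {0..t}"
        by (rule absolutely_integrable_on_subinterval[OF g]) (use t in auto)
      show ?thesis
        using set_integral_add(2)[OF 1 2] 1 2
        by (simp add: deriv_V set_lebesgue_integral_eq_integral)
    qed
    with elim show ?case by simp
  qed
qed

section \<open>The gradient at the zero control\<close>

text \<open>By \<open>path_perturbation\<close> and \<open>second_moment_expansion\<close> the
difference quotient in direction \<open>h\<close> tends to the expectation of \<open>v T *
Y\<close>, where \<open>Y\<close> integrates \<open>h\<close> against the sensitivity; Fubini's
theorem moves the expectation inside the time integral. The error is at most a multiple of
\<open>\<bar>\<delta>\<bar>\<close>.\<close>

lemma gradient_at_zero:
  fixes v :: "real \<Rightarrow> 'a \<Rightarrow> real"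
  assumes "prob_space M" and T: "0 < T"
    and sol: "\<And>g. g \<in> L6 T \<Longrightarrow> sde_solution M B \<sigma> T g (u g)"
    and v: "\<And>s. v s \<in> borel_measurable M" "\<And>\<omega>. continuous_on UNIV (\<lambda>s. v s \<omega>)"
    and vu: "AE \<omega> in M. \<forall>t\<in>{0..T}. v t \<omega> = u (\<lambda>_. 0) t \<omega>"
    and X2: "integrable M (\<lambda>\<omega>. (v T \<omega>)\<^sup>2)"
  shows "is_gradient T (cost M T u) (\<lambda>_. 0)
    (\<lambda>s. \<integral>\<omega>. v T \<omega> * sensitivity (\<lambda>r. v r \<omega>) T s \<partial>M)"
  unfolding is_gradient_def
proof (intro ballI)
  interpret prob_space M by fact
  let ?N = "lebesgue_on {0..T}" and ?K = "\<lambda>\<omega>. sensitivity (\<lambda>r. v r \<omega>) T"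
  let ?G = "\<lambda>s. \<integral>\<omega>. v T \<omega> * ?K \<omega> s \<partial>M"
  fix h assume h: "h \<in> L6 T"
  have hA: "h absolutely_integrable_on {0..T}" by (rule L6_imp_absolutely_integrable[OF h])
  then have hN: "integrable ?N h" by (simp add: absolutely_integrable_imp_integrable)
  have X1: "integrable M (v T)" by (rule square_integrable_imp_integrable[OF v(1) X2])
  have sf: "sigma_finite_measure ?N"
    using finite_measure_lebesgue_on[of "{0..T}"] by (auto intro: finite_measure.axioms)
  have vc: "continuous_on S (\<lambda>r. v r \<omega>)" for S \<omega> by (rule continuous_on_subset[OF v(2)]) auto
  have bound: "\<bar>?K \<omega> s\<bar> \<le> exp T" if "s \<in> space ?N" for \<omega> s
  proof -
    have s: "s \<in> {0..T}" using that by simp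
    then have "exp (T - s) \<le> exp T" by simp
    then show ?thesis using sensitivity_bounds[OF vc s, of \<omega>] by linarith
  qed
  define Y where "Y \<omega> = integral {0..T} (\<lambda>s. ?K \<omega> s * h s)" for \<omega>
  have Y: "(\<integral>s. ?K \<omega> s * h s \<partial>?N) = Y \<omega>" for \<omega>
    unfolding Y_def
    by (intro lebesgue_integral_eq_integral absolutely_integrable_imp_integrable
        absolutely_integrable_continuous_mult continuous_on_sensitivity vc hA) auto
  note fubini = Fubini_bounded_kernel[OF sigma_finite_measure_axioms sf X1 hN
      sensitivity_measurable[OF v] bound, unfolded Y]
  have XY: "integrable M (\<lambda>\<omega>. v T \<omega> * Y \<omega>)" by (rule fubini(2))
  have Gh: "integrable ?N (\<lambda>s. ?G s * h s)" by (rule fubini(1))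
  show "(\<lambda>s. ?G s * h s) absolutely_integrable_on {0..T} \<and>
    ((\<lambda>\<delta>. 1 / \<delta> * (cost M T u (\<lambda>t. 0 + \<delta> * h t) - cost M T u (\<lambda>_. 0)))
      \<longlongrightarrow> (LINT t:{0..T}|lebesgue. ?G t * h t)) (at 0)"
  proof (rule conjI)
    show "(\<lambda>s. ?G s * h s) absolutely_integrable_on {0..T}"
      using Gh by (simp add: set_integrable_def integrable_restrict_space)
    have "(LINT t:{0..T}|lebesgue. ?G t * h t) = (\<integral>s. ?G s * h s \<partial>?N)"
      by (simp add: set_lebesgue_integral_def integral_restrict_space)
    also have "\<dots> = expectation (\<lambda>\<omega>. v T \<omega> * Y \<omega>)" by (rule fubini(3)[symmetric])
    finally have I: "(LINT t:{0..T}|lebesgue. ?G t * h t) = expectation (\<lambda>\<omega>. v T \<omega> * Y \<omega>)" .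
    define C where "C = integral {0..T} (\<lambda>s. \<bar>h s\<bar>) * exp T"
    define L where "L = C\<^sup>2 * T * exp T * expectation (\<lambda>\<omega>. \<bar>v T \<omega>\<bar>) + C\<^sup>2 / 2"
    have u0: "AE \<omega> in M. continuous_on {0..T} (\<lambda>t. u (\<lambda>_. 0) t \<omega>) \<and>
      (\<forall>t\<in>{0..T}. u (\<lambda>_. 0) t \<omega> = integral {0..t} (\<lambda>s. drift (u (\<lambda>_. 0) s \<omega>)) + integral {0..t} (\<lambda>_. 0) + \<sigma> * B t \<omega>)"
      by (rule sde_solution_paths[OF sol[OF L6_zero] L6_imp_absolutely_integrable[OF L6_zero]])
    have c0: "cost M T u (\<lambda>_. 0) = expectation (\<lambda>\<omega>. 1/2 * (v T \<omega>)\<^sup>2)"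
    proof -
      have [measurable]: "u (\<lambda>_. 0) T \<in> borel_measurable M" "v T \<in> borel_measurable M"
        using sol[OF L6_zero] T v(1) by (auto simp: sde_solution_def)
      show ?thesis unfolding cost_def
        by (rule integral_cong_AE) (use vu T in \<open>auto elim!: eventually_mono\<close>)
    qed
    have expansion: "\<bar>cost M T u (\<lambda>t. 0 + \<delta> * h t) - cost M T u (\<lambda>_. 0)
        - \<delta> * expectation (\<lambda>\<omega>. v T \<omega> * Y \<omega>)\<bar> \<le> \<delta>\<^sup>2 * L" for \<delta>
    proof -
      let ?g = "\<lambda>t. 0 + \<delta> * h t"
      have g: "?g \<in> L6 T" using L6_scale[OF h, of \<delta>] by simp
      have "AE \<omega> in M. \<bar>u ?g T \<omega> - v T \<omega>\<bar> \<le> \<bar>\<delta>\<bar> * C \<and>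
          \<bar>u ?g T \<omega> - v T \<omega> - \<delta> * Y \<omega>\<bar> \<le> \<delta>\<^sup>2 * (C\<^sup>2 * T * exp T)"
        using u0 vu sde_solution_paths[OF sol[OF g] L6_imp_absolutely_integrable[OF g]]
      proof eventually_elim
        case (elim \<omega>)
        have x: "v t \<omega> = integral {0..t} (\<lambda>s. drift (v s \<omega>)) + \<sigma> * B t \<omega>" if t: "t \<in> {0..T}" for t
        proof -
          have "integral {0..t} (\<lambda>s. drift (u (\<lambda>_. 0) s \<omega>)) = integral {0..t} (\<lambda>s. drift (v s \<omega>))"
            by (rule Henstock_Kurzweil_Integration.integral_cong) (use elim(2) t in auto)
          then show ?thesis using elim(1,2) t by auto
        qed
        have y: "u ?g t \<omega> = integral {0..t} (\<lambda>s. drift (u ?g s \<omega>)) + \<delta> * integral {0..t} h + \<sigma> * B t \<omega>"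
          if "t \<in> {0..T}" for t
          using elim(3) that by simp
        show ?case
          using path_perturbation[where x = "\<lambda>t. v t \<omega>" and y = "\<lambda>t. u ?g t \<omega>"
              and w = "\<lambda>t. \<sigma> * B t \<omega>" and \<delta> = \<delta>, OF less_imp_le[OF T] hA vc conjunct1[OF elim(3)] x y]
          unfolding C_def Y_def by blast
      qed
      then have D: "AE \<omega> in M. \<bar>u ?g T \<omega> - v T \<omega>\<bar> \<le> \<bar>\<delta>\<bar> * C"
        and R: "AE \<omega> in M. \<bar>u ?g T \<omega> - v T \<omega> - \<delta> * Y \<omega>\<bar> \<le> \<delta>\<^sup>2 * (C\<^sup>2 * T * exp T)"
        by auto
      have m: "u ?g T \<in> borel_measurable M" using sol[OF g] T by (simp add: sde_solution_def)
      show ?thesis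
        using second_moment_expansion[OF v(1) m X2 XY D R] unfolding c0 L_def by (simp add: cost_def)
    qed
    have "((\<lambda>\<delta>. 1 / \<delta> * (cost M T u (\<lambda>t. 0 + \<delta> * h t) - cost M T u (\<lambda>_. 0))
        - expectation (\<lambda>\<omega>. v T \<omega> * Y \<omega>)) \<longlongrightarrow> 0) (at 0)"
    proof (rule Lim_null_comparison)
      show "((\<lambda>\<delta>. \<bar>\<delta>\<bar> * L) \<longlongrightarrow> 0) (at 0)" by (auto intro!: tendsto_eq_intros)
      show "\<forall>\<^sub>F \<delta> in at 0. norm (1 / \<delta> * (cost M T u (\<lambda>t. 0 + \<delta> * h t) - cost M T u (\<lambda>_. 0))
        - expectation (\<lambda>\<omega>. v T \<omega> * Y \<omega>)) \<le> \<bar>\<delta>\<bar> * L"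
        unfolding eventually_at_filter
      proof (intro always_eventually allI impI)
        fix \<delta> :: real assume \<delta>: "\<delta> \<noteq> 0"
        let ?d = "cost M T u (\<lambda>t. 0 + \<delta> * h t) - cost M T u (\<lambda>_. 0)"
        have "1 / \<delta> * ?d - expectation (\<lambda>\<omega>. v T \<omega> * Y \<omega>)
            = (?d - \<delta> * expectation (\<lambda>\<omega>. v T \<omega> * Y \<omega>)) / \<delta>" (is "?l = ?r")
          using \<delta> by (simp add: field_simps)
        then have "norm ?l = norm ?r" by (rule arg_cong)
        also have "\<dots> = \<bar>?d - \<delta> * expectation (\<lambda>\<omega>. v T \<omega> * Y \<omega>)\<bar> / \<bar>\<delta>\<bar>"
          by (simp only: real_norm_def abs_divide)
        also have "\<dots> \<le> \<delta>\<^sup>2 * L / \<bar>\<delta>\<bar>" using expansion[of \<delta>] by (intro divide_right_mono) auto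
        also have "\<dots> = \<bar>\<delta>\<bar> * L"
          using \<delta> by (simp add: power2_eq_square abs_if)
        finally show "norm (1 / \<delta> * ?d - expectation (\<lambda>\<omega>. v T \<omega> * Y \<omega>)) \<le> \<bar>\<delta>\<bar> * L" .
      qed
    qed
    then show "((\<lambda>\<delta>. 1 / \<delta> * (cost M T u (\<lambda>t. 0 + \<delta> * h t) - cost M T u (\<lambda>_. 0)))
      \<longlongrightarrow> (LINT t:{0..T}|lebesgue. ?G t * h t)) (at 0)"
      unfolding I by (simp add: LIM_zero_iff)
  qed
qed

text \<open>Since the drift is nonnegative, \<open>x T - \<sigma> * B T\<close> is nonnegative,
and it is at most \<open>T\<close>. If its mean vanished, it would vanish almost surely; then the
drift would vanish along the whole path, which keeps the path nonpositive, so that \<open>B T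
\<le> 0\<close> almost surely. This is impossible, because \<open>B T\<close> has mean zero and
positive variance.\<close>

lemma uncontrolled_state_moments:
  assumes "prob_space M" and BM: "brownian_motion M B" and T: "0 < T" and \<sigma>: "0 < \<sigma>"
    and sol: "sde_solution M B \<sigma> T (\<lambda>_. 0) x"
  shows "integrable M (\<lambda>\<omega>. (x T \<omega>)\<^sup>2)" "0 < (\<integral>\<omega>. x T \<omega> \<partial>M)"
proof -
  interpret prob_space M by fact
  note B = brownian_motion_moments[OF BM T]
  have [measurable]: "x T \<in> borel_measurable M" "B T \<in> borel_measurable M"
    using sol BM T by (auto simp: sde_solution_def brownian_motion_def)
  have paths: "AE \<omega> in M. continuous_on {0..T} (\<lambda>t. drift (x t \<omega>)) \<and>
      x T \<omega> - \<sigma> * B T \<omega> = integral {0..T} (\<lambda>s. drift (x s \<omega>))"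
    using sde_solution_paths[OF sol L6_imp_absolutely_integrable[OF L6_zero]]
    by eventually_elim (use T in \<open>auto intro: continuous_on_compose2[OF continuous_on_drift]\<close>)
  then have I: "AE \<omega> in M. 0 \<le> x T \<omega> - \<sigma> * B T \<omega> \<and> x T \<omega> - \<sigma> * B T \<omega> \<le> T"
  proof eventually_elim
    case (elim \<omega>)
    have i: "(\<lambda>s. drift (x s \<omega>)) integrable_on {0..T}"
      using elim by (intro integrable_continuous_real) auto
    have "integral {0..T} (\<lambda>s. drift (x s \<omega>)) \<le> integral {0..T} (\<lambda>s. 1)"
      by (intro integral_le i) (auto simp: drift_le_one)
    then show ?case using elim T integral_nonneg[OF i] by (simp add: drift_nonneg)
  qed
  show X2: "integrable M (\<lambda>\<omega>. (x T \<omega>)\<^sup>2)"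
  proof (rule Bochner_Integration.integrable_bound)
    show "integrable M (\<lambda>\<omega>. 2 * T\<^sup>2 + 2 * \<sigma>\<^sup>2 * (B T \<omega>)\<^sup>2)" using B(2) by simp
    show "AE \<omega> in M. norm ((x T \<omega>)\<^sup>2) \<le> norm (2 * T\<^sup>2 + 2 * \<sigma>\<^sup>2 * (B T \<omega>)\<^sup>2)"
      using I
    proof eventually_elim
      case (elim \<omega>)
      define d where "d = x T \<omega> - \<sigma> * B T \<omega>"
      have "d\<^sup>2 \<le> T\<^sup>2" using elim by (intro power_mono) (auto simp: d_def)
      moreover have "(x T \<omega>)\<^sup>2 \<le> 2 * d\<^sup>2 + 2 * (\<sigma> * B T \<omega>)\<^sup>2"
        using zero_le_power2[of "d - \<sigma> * B T \<omega>"] unfolding d_def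
        by (simp add: power2_eq_square algebra_simps)
      ultimately show ?case by (simp add: power_mult_distrib)
    qed
  qed measurable
  have X1: "integrable M (x T)" by (rule square_integrable_imp_integrable[OF _ X2]) simp
  have E: "expectation (\<lambda>\<omega>. x T \<omega> - \<sigma> * B T \<omega>) = expectation (x T)" using X1 B(1,3) by simp
  have "0 \<le> expectation (x T)" unfolding E[symmetric] using I by (intro integral_nonneg_AE) auto
  moreover have "expectation (x T) \<noteq> 0"
  proof
    assume "expectation (x T) = 0"
    then have "AE \<omega> in M. x T \<omega> - \<sigma> * B T \<omega> = 0"
      using integral_nonneg_eq_0_iff_AE[of M "\<lambda>\<omega>. x T \<omega> - \<sigma> * B T \<omega>"] X1 B(1) I E by auto
    with paths have "AE \<omega> in M. B T \<omega> \<le> 0"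
    proof eventually_elim
      case (elim \<omega>)
      then have "\<forall>s\<in>{0..T}. drift (x s \<omega>) = 0"
        using integral_eq_0_iff[of 0 T "\<lambda>s. drift (x s \<omega>)"] T by (simp add: drift_nonneg)
      then have "drift (x T \<omega>) = 0" using T by simp
      then have "x T \<omega> \<le> 0" using drift_pos[of "x T \<omega>"] by linarith
      then show ?case using elim \<sigma> by (simp add: mult_le_0_iff)
    qed
    with B(4) show False by contradiction
  qed
  ultimately show "0 < expectation (x T)" by simp
qed

text \<open>At \<open>s = T\<close> the sensitivity is \<open>1\<close>, so the gradient equals
the mean of the terminal state there. Since the sensitivity lies between \<open>1\<close> and
\<open>exp (T - s)\<close>, the gradient stays above half that mean for \<open>s\<close> close to
\<open>T\<close>.\<close>

lemma gradient_pos_near_terminal_time: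
  fixes v :: "real \<Rightarrow> 'a \<Rightarrow> real"
  assumes "prob_space M" and T: "0 < T"
    and v: "\<And>s. v s \<in> borel_measurable M" "\<And>\<omega>. continuous_on UNIV (\<lambda>s. v s \<omega>)"
    and X1: "integrable M (v T)" and pos: "0 < (\<integral>\<omega>. v T \<omega> \<partial>M)"
  obtains \<epsilon> c where "0 < \<epsilon>" "\<epsilon> \<le> T" "0 < c"
    "\<forall>s\<in>{T - \<epsilon>..T}. c \<le> (\<integral>\<omega>. v T \<omega> * sensitivity (\<lambda>r. v r \<omega>) T s \<partial>M)"
proof -
  interpret prob_space M by fact
  let ?A = "expectation (\<lambda>\<omega>. \<bar>v T \<omega>\<bar>)" and ?m = "expectation (v T)"
  have "((\<lambda>e. (exp e - 1) * ?A) \<longlongrightarrow> 0) (at_right 0)"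
    by (auto intro!: tendsto_eq_intros)
  then have "\<forall>\<^sub>F e in at_right 0. (exp e - 1) * ?A < ?m / 2"
    using pos by (intro order_tendstoD) auto
  then obtain b where b: "0 < b" "\<And>e. 0 < e \<Longrightarrow> e < b \<Longrightarrow> (exp e - 1) * ?A < ?m / 2"
    by (auto simp: eventually_at_right_field)
  define \<epsilon> where "\<epsilon> = min T (b / 2)"
  have \<epsilon>: "0 < \<epsilon>" "\<epsilon> \<le> T" and "\<epsilon> < b" using b(1) T by (auto simp: \<epsilon>_def)
  then have \<epsilon>': "(exp \<epsilon> - 1) * ?A < ?m / 2" by (intro b(2))
  show ?thesis
  proof (intro that[OF \<epsilon>, of "?m / 2"] ballI)
    fix s assume s: "s \<in> {T - \<epsilon>..T}"
    let ?K = "\<lambda>\<omega>. sensitivity (\<lambda>r. v r \<omega>) T s"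
    have s0: "s \<in> {0..T}" using s \<epsilon>(2) by auto
    have K: "1 \<le> ?K \<omega>" "?K \<omega> \<le> exp \<epsilon>" for \<omega>
    proof -
      have c: "continuous_on {0..T} (\<lambda>r. v r \<omega>)" by (rule continuous_on_subset[OF v(2)]) auto
      have "exp (T - s) \<le> exp \<epsilon>" using s by simp
      then show "1 \<le> ?K \<omega>" "?K \<omega> \<le> exp \<epsilon>" using sensitivity_bounds[OF c s0] by linarith+
    qed
    have Km: "?K \<in> borel_measurable M"
      using measurable_Pair2'[of s "lebesgue_on {0..T}" M] s0
        measurable_compose[OF _ sensitivity_measurable[OF v], of "\<lambda>\<omega>. (\<omega>, s)" M T] by simp
    have KX: "integrable M (\<lambda>\<omega>. v T \<omega> * ?K \<omega>)"
    proof (rule Bochner_Integration.integrable_bound)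
      show "integrable M (\<lambda>\<omega>. exp \<epsilon> * v T \<omega>)" using X1 by simp
      show "AE \<omega> in M. norm (v T \<omega> * ?K \<omega>) \<le> norm (exp \<epsilon> * v T \<omega>)"
      proof (rule AE_I2)
        fix \<omega>
        have "\<bar>?K \<omega>\<bar> * \<bar>v T \<omega>\<bar> \<le> exp \<epsilon> * \<bar>v T \<omega>\<bar>" using K[of \<omega>] by (intro mult_right_mono) auto
        then show "norm (v T \<omega> * ?K \<omega>) \<le> norm (exp \<epsilon> * v T \<omega>)" by (simp add: abs_mult mult.commute)
      qed
    qed (use v(1) Km in measurable)
    have "?m - (exp \<epsilon> - 1) * ?A = expectation (\<lambda>\<omega>. v T \<omega> - (exp \<epsilon> - 1) * \<bar>v T \<omega>\<bar>)"
      using X1 by simp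
    also have "\<dots> \<le> expectation (\<lambda>\<omega>. v T \<omega> * ?K \<omega>)"
    proof (rule integral_mono)
      fix \<omega>
      have "\<bar>v T \<omega>\<bar> * \<bar>?K \<omega> - 1\<bar> \<le> \<bar>v T \<omega>\<bar> * (exp \<epsilon> - 1)"
        using K[of \<omega>] by (intro mult_left_mono) auto
      then have "\<bar>v T \<omega> * (?K \<omega> - 1)\<bar> \<le> (exp \<epsilon> - 1) * \<bar>v T \<omega>\<bar>"
        by (simp add: abs_mult mult.commute)
      then show "v T \<omega> - (exp \<epsilon> - 1) * \<bar>v T \<omega>\<bar> \<le> v T \<omega> * ?K \<omega>"
        by (simp add: algebra_simps abs_le_iff)
    qed (use X1 KX in simp_all)
    finally show "?m / 2 \<le> expectation (\<lambda>\<omega>. v T \<omega> * ?K \<omega>)" using \<epsilon>' by simp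
  qed (use pos in simp)
qed

text \<open>Zero is a solution because the drift vanishes at \<open>0\<close>, and
\<open>path_perturbation\<close> with \<open>\<delta> = 0\<close> is a uniqueness
statement.\<close>

lemma noise_free_uncontrolled_state:
  assumes T: "0 \<le> T" and sol: "sde_solution M B 0 T (\<lambda>_. 0) x"
  shows "AE \<omega> in M. x T \<omega> = 0"
  using sde_solution_paths[OF sol L6_imp_absolutely_integrable[OF L6_zero]]
proof eventually_elim
  case (elim \<omega>)
  have "\<bar>x T \<omega> - 0\<bar> \<le> \<bar>0\<bar> * (integral {0..T} (\<lambda>s::real. \<bar>0\<bar>) * exp T)"
    by (rule path_perturbation(1)[where x = "\<lambda>_. 0" and w = "\<lambda>_. 0" and h = "\<lambda>_. 0"])
      (use T elim in \<open>auto simp: drift_def\<close>)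
  then show ?case by simp
qed

text \<open>The cost increases along \<open>h\<close>, so it decreases along \<open>- h\<close>;
hence the passage to the limit from the left.\<close>

lemma zero_not_optimal_if_gradient_nonzero:
  assumes grad: "is_gradient T J (\<lambda>_. 0) G" and h: "h \<in> L6 T"
    and nz: "0 < (LINT t:{0..T}|lebesgue. G t * h t)"
  shows "\<not> is_optimal_control T J (\<lambda>_. 0)"
proof
  assume opt: "is_optimal_control T J (\<lambda>_. 0)"
  have "((\<lambda>\<delta>. 1/\<delta> * (J (\<lambda>t. 0 + \<delta> * h t) - J (\<lambda>_. 0)))
      \<longlongrightarrow> (LINT t:{0..T}|lebesgue. G t * h t)) (at_left 0)"
    using grad h unfolding is_gradient_def by (intro filterlim_at_split[THEN iffD1, THEN conjunct1]) blast
  then have "\<forall>\<^sub>F \<delta> in at_left 0. 0 < 1/\<delta> * (J (\<lambda>t. 0 + \<delta> * h t) - J (\<lambda>_. 0))"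
    using nz by (rule order_tendstoD)
  moreover have "\<forall>\<^sub>F \<delta>::real in at_left 0. \<delta> < 0" by (simp add: eventually_at_filter)
  ultimately have "\<forall>\<^sub>F \<delta>::real in at_left 0. False"
  proof eventually_elim
    case (elim \<delta>)
    have "J (\<lambda>_. 0) \<le> J (\<lambda>t. 0 + \<delta> * h t)"
      using opt L6_scale[OF h, of \<delta>] unfolding is_optimal_control_def by simp
    with elim show False by (simp add: zero_less_divide_iff)
  qed
  then show False by simp
qed

theorem mainTheorem7:
  fixes M :: "'a measure" and B :: "real \<Rightarrow> 'a \<Rightarrow> real" and T \<sigma> :: real
    and u :: "(real \<Rightarrow> real) \<Rightarrow> real \<Rightarrow> 'a \<Rightarrow> real"
  assumes "prob_space M"
    and "brownian_motion M B"
    and "T > 0"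
    and "\<sigma> \<ge> 0"
    and "\<And>g. g \<in> L6 T \<Longrightarrow> sde_solution M B \<sigma> T g (u g)"
  shows "(\<sigma> = 0 \<longrightarrow> is_optimal_control T (cost M T u) (\<lambda>_. 0)) \<and>
    (\<sigma> > 0 \<longrightarrow>
       (\<exists>G. is_gradient T (cost M T u) (\<lambda>_. 0) G) \<and>
       (\<forall>G. is_gradient T (cost M T u) (\<lambda>_. 0) G \<longrightarrow>
          \<not> (AE t in lebesgue_on {0..T}. G t = 0)) \<and>
       \<not> is_optimal_control T (cost M T u) (\<lambda>_. 0))"
proof (intro conjI[of "_ \<longrightarrow> _"] impI)
  assume "\<sigma> = 0"
  then have sol0: "sde_solution M B 0 T (\<lambda>_. 0) (u (\<lambda>_. 0))" using assms(5)[OF L6_zero] by simp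
  have "AE \<omega> in M. 1/2 * (u (\<lambda>_. 0) T \<omega>)\<^sup>2 = 0"
    using noise_free_uncontrolled_state[OF less_imp_le[OF assms(3)] sol0] by eventually_elim simp
  then have "cost M T u (\<lambda>_. 0) = 0" unfolding cost_def by (rule integral_eq_zero_AE)
  then show "is_optimal_control T (cost M T u) (\<lambda>_. 0)"
    by (auto simp: is_optimal_control_def L6_zero cost_def intro!: Bochner_Integration.integral_nonneg)
next
  assume \<sigma>: "0 < \<sigma>"
  let ?J = "cost M T u" and ?u0 = "u (\<lambda>_. 0)"
  have sol0: "sde_solution M B \<sigma> T (\<lambda>_. 0) ?u0" by (rule assms(5)[OF L6_zero])
  obtain v where v: "\<And>s. v s \<in> borel_measurable M" "\<And>\<omega>. continuous_on UNIV (\<lambda>s. v s \<omega>)"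
    and vu: "AE \<omega> in M. \<forall>t\<in>{0..T}. v t \<omega> = ?u0 t \<omega>"
    by (rule regular_version[of T ?u0 M])
      (use sol0 assms(3) in \<open>auto simp: sde_solution_def elim: eventually_mono\<close>)
  have vT: "AE \<omega> in M. ?u0 T \<omega> = v T \<omega>" using vu by eventually_elim (use assms(3) in auto)
  note mom = uncontrolled_state_moments[OF assms(1-3) \<sigma> sol0]
  have [measurable]: "?u0 T \<in> borel_measurable M" "v T \<in> borel_measurable M"
    using sol0 assms(3) v(1) by (auto simp: sde_solution_def)
  have X2: "integrable M (\<lambda>\<omega>. (v T \<omega>)\<^sup>2)"
    by (rule Bochner_Integration.integrable_cong_AE_imp[OF mom(1)]) (use vT in \<open>auto elim: eventually_mono\<close>)
  have "(\<integral>\<omega>. ?u0 T \<omega> \<partial>M) = (\<integral>\<omega>. v T \<omega> \<partial>M)" by (rule integral_cong_AE) (use vT in auto)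
  with mom(2) have pos: "0 < (\<integral>\<omega>. v T \<omega> \<partial>M)" by simp
  define G where "G s = (\<integral>\<omega>. v T \<omega> * sensitivity (\<lambda>r. v r \<omega>) T s \<partial>M)" for s
  have grad: "is_gradient T ?J (\<lambda>_. 0) G"
    unfolding G_def by (rule gradient_at_zero[OF assms(1,3,5) v vu X2])
  interpret prob_space M by (rule assms(1))
  obtain \<epsilon> c where \<epsilon>: "0 < \<epsilon>" "\<epsilon> \<le> T" "0 < c" "\<forall>s\<in>{T - \<epsilon>..T}. c \<le> G s"
    unfolding G_def
    by (rule gradient_pos_near_terminal_time[OF assms(1,3) v
          square_integrable_imp_integrable[OF v(1) X2] pos])
  let ?h = "indicator {T - \<epsilon>..T} :: real \<Rightarrow> real"
  have h: "?h \<in> L6 T" by (rule L6_indicator)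
  have Gh: "set_integrable lebesgue {0..T} (\<lambda>t. G t * ?h t)"
    using grad h by (auto simp: is_gradient_def)
  have "0 < c * \<epsilon>" using \<epsilon> by simp
  also have "c * \<epsilon> = (\<integral>t. c * ?h t \<partial>lebesgue)" using \<epsilon>(1) by simp
  also have "\<dots> \<le> (LINT t:{0..T}|lebesgue. G t * ?h t)"
    unfolding set_lebesgue_integral_def
  proof (rule integral_mono)
    show "integrable lebesgue (\<lambda>t. c * ?h t)"
      by (intro integrable_mult_right integrable_real_indicator) (auto simp: emeasure_lborel_Icc_eq)
    show "integrable lebesgue (\<lambda>t. indicator {0..T} t *\<^sub>R (G t * ?h t))"
      using Gh by (simp add: set_integrable_def)
    show "c * ?h t \<le> indicator {0..T} t *\<^sub>R (G t * ?h t)" for t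
      using \<epsilon>(2,4) by (auto split: split_indicator)
  qed
  finally have nz: "0 < (LINT t:{0..T}|lebesgue. G t * ?h t)" .
  have "\<not> (AE t in lebesgue_on {0..T}. G' t = 0)" if G': "is_gradient T ?J (\<lambda>_. 0) G'" for G'
  proof
    assume "AE t in lebesgue_on {0..T}. G' t = 0"
    then have "AE t in lebesgue. indicator {0..T} t *\<^sub>R (G' t * ?h t) = 0"
      by (auto simp: AE_restrict_space_iff elim!: eventually_mono split: split_indicator)
    then have "(LINT t:{0..T}|lebesgue. G' t * ?h t) = 0"
      unfolding set_lebesgue_integral_def by (rule integral_eq_zero_AE)
    moreover have "(LINT t:{0..T}|lebesgue. G' t * ?h t) = (LINT t:{0..T}|lebesgue. G t * ?h t)"
      using grad G' h unfolding is_gradient_def by (blast intro: tendsto_unique[OF at_neq_bot])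
    ultimately show False using nz by simp
  qed
  moreover have "\<not> is_optimal_control T ?J (\<lambda>_. 0)"
    by (rule zero_not_optimal_if_gradient_nonzero[OF grad h nz])
  ultimately show "(\<exists>G. is_gradient T ?J (\<lambda>_. 0) G) \<and>
       (\<forall>G. is_gradient T ?J (\<lambda>_. 0) G \<longrightarrow> \<not> (AE t in lebesgue_on {0..T}. G t = 0)) \<and>
       \<not> is_optimal_control T ?J (\<lambda>_. 0)"
    using grad by blast
qed

end
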